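(* Let $T\in\mathbb{R}^D$ be a value of interest that is estimated using $n$ i.i.d. data points. Assume that there is an estimator $\widehat E_n\in\mathbb{R}^D$, computed from $n$ data points, that satisfies the following, for a fixed exponent $r$: for any $\varepsilon>0$ there are $\bar N_\varepsilon$ and $\bar C_\varepsilon$ such that for any $n>\bar N_\varepsilon$, $$\Pr\left(\|\widehat E_n-T\|>\frac{\bar C_\varepsilon}{n^r}\right)\le\varepsilon.$$ Then there are global constants $C_0$, $c_0$ and $N_0$ such that for any $\varepsilon>0$ and for any $n>N_\varepsilon$, the vector-valued median trick (defined in the context) returns $\widehat T_n$ satisfying $$\Pr\left(\|\widehat T_n-T\|>\frac{C_\varepsilon}{n^r}\right)\le\varepsilon,$$ where $$N_\varepsilon=N_0\ln\frac1\varepsilon,\qquad C_\varepsilon=C_0\left(c_0\ln\frac1\varepsilon\right)^r.$$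
   Context: $\|\cdot\|$ is the Euclidean norm on $\mathbb{R}^D$. Vector-valued median trick built on the given estimator $\widehat E_n$ (for failure probability $\varepsilon$). 1. Split the $n$ data points into $\nu=O(\ln\frac1\varepsilon)$ equal parts. 2. Apply the given estimator to each part (so with $n/\nu$ data points in place of $n$) to get $\widehat T^1_{n/\nu},\dots,\widehat T^\nu_{n/\nu}\in\mathbb{R}^D$. 3. Find a ball of radius $2\,\bar C_{\varepsilon_0}\nu^r/n^r$ that has more than half of the estimates $\widehat T^i_{n/\nu}$ in it. 4. Return $\widehat T_n$, the center of that ball. Here $\varepsilon_0\in(0,0.5)$ is a fixed auxiliary failure probability and $\bar C_{\varepsilon_0}$ is the constant that the assumed guarantee on $\widehat E_n$ provides for $\varepsilon=\varepsilon_0$.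
   Formalization: "For any ε>0" fails as ε→1, where C_ε→0 for r>0 (and C_ε is undefined for ε>1); proved for 0<ε≤ε_max with any fixed ε_max<1, the constants depending on ε_max. The number of parts ν is taken between κ ln(1/ε) and K ln(1/ε), with κ depending only on ε₀. *)

theory Defs
  imports "HOL-Probability.Probability"
begin

definition iid_data :: "'w measure \<Rightarrow> 'b measure \<Rightarrow> (nat \<Rightarrow> 'w \<Rightarrow> 'b) \<Rightarrow> bool" where
  "iid_data M S X \<longleftrightarrow>
     prob_space M \<and>
     prob_space.indep_vars M (\<lambda>_. S) X UNIV \<and>
     (\<forall>i. distr M S (X i) = distr M S (X 0))"

text \<open>The \<open>j\<close>-th of the consecutive parts of size \<open>m\<close>, as an \<open>m\<close>-tuple, i.e. a point of the
  product space over \<open>{..<m}\<close>.\<close>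

definition part :: "(nat \<Rightarrow> 'w \<Rightarrow> 'b) \<Rightarrow> nat \<Rightarrow> nat \<Rightarrow> 'w \<Rightarrow> nat \<Rightarrow> 'b" where
  "part X m j \<omega> = (\<lambda>i\<in>{..<m}. X (j * m + i) \<omega>)"

definition is_estimator :: "'b measure \<Rightarrow> (nat \<Rightarrow> (nat \<Rightarrow> 'b) \<Rightarrow> real ^ 'd) \<Rightarrow> bool" where
  "is_estimator S E \<longleftrightarrow> (\<forall>n. E n \<in> borel_measurable (PiM {..<n} (\<lambda>_. S)))"

text \<open>\<open>part X n 0\<close> consists of the first \<open>n\<close> data points.\<close>

definition estimator_guarantee ::
  "'w measure \<Rightarrow> (nat \<Rightarrow> 'w \<Rightarrow> 'b) \<Rightarrow> (nat \<Rightarrow> (nat \<Rightarrow> 'b) \<Rightarrow> real ^ 'd) \<Rightarrow> real ^ 'd \<Rightarrow> real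
     \<Rightarrow> (real \<Rightarrow> real) \<Rightarrow> (real \<Rightarrow> real) \<Rightarrow> bool" where
  "estimator_guarantee M X E T r Nbar Cbar \<longleftrightarrow>
     (\<forall>\<epsilon>>0. \<forall>n>0. real n > Nbar \<epsilon> \<longrightarrow>
        measure M {\<omega> \<in> space M. norm (E n (part X n 0 \<omega>) - T) > Cbar \<epsilon> / real n powr r} \<le> \<epsilon>)"

text \<open>The number of parts is of order \<open>ln (1/\<epsilon>)\<close>, uniformly for \<open>0 < \<epsilon> \<le> \<epsilon>max\<close>. The lower bound is
  needed because the failure probability cannot be brought below \<open>\<epsilon>\<close> with too few parts.\<close>

definition log_many_parts :: "real \<Rightarrow> real \<Rightarrow> real \<Rightarrow> (real \<Rightarrow> nat) \<Rightarrow> bool" where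
  "log_many_parts \<kappa> K \<epsilon>max \<nu> \<longleftrightarrow>
     (\<forall>\<epsilon>. 0 < \<epsilon> \<and> \<epsilon> \<le> \<epsilon>max \<longrightarrow>
        \<kappa> * ln (1 / \<epsilon>) \<le> real (\<nu> \<epsilon>) \<and> real (\<nu> \<epsilon>) \<le> K * ln (1 / \<epsilon>))"

definition majority_ball :: "nat \<Rightarrow> (nat \<Rightarrow> real ^ 'd) \<Rightarrow> real \<Rightarrow> real ^ 'd \<Rightarrow> bool" where
  "majority_ball k t \<rho> c \<longleftrightarrow> real (card {j. j < k \<and> t j \<in> cball c \<rho>}) > real k / 2"

text \<open>\<open>That\<close> is a possible output of the median trick with \<open>k\<close> parts on \<open>n\<close> data points, where \<open>C\<close> is
  the constant in the radius. The parts have size \<open>n div k\<close>; if \<open>k\<close> does not divide \<open>n\<close>, the fewer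
  than \<open>k\<close> remaining points are discarded. Which of the suitable balls is found is left open, and
  the output is unconstrained where there is none. Measurability of the output is required since
  \<open>measure\<close> is \<open>0\<close> on non-measurable sets.\<close>

definition median_trick ::
  "'w measure \<Rightarrow> (nat \<Rightarrow> 'w \<Rightarrow> 'b) \<Rightarrow> (nat \<Rightarrow> (nat \<Rightarrow> 'b) \<Rightarrow> real ^ 'd) \<Rightarrow> real \<Rightarrow> real
     \<Rightarrow> nat \<Rightarrow> nat \<Rightarrow> ('w \<Rightarrow> real ^ 'd) \<Rightarrow> bool" where
  "median_trick M X E r C k n That \<longleftrightarrow>
     That \<in> borel_measurable M \<and>
     (\<forall>\<omega> \<in> space M.
        let t = (\<lambda>j. E (n div k) (part X (n div k) j \<omega>));
            \<rho> = 2 * C * real k powr r / real n powr r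
        in (\<exists>c. majority_ball k t \<rho> c) \<longrightarrow> majority_ball k t \<rho> (That \<omega>))"

end

theory Submission imports Defs begin

text \<open>
  Two balls that each contain more than half of the estimates share one of them. So if the ball of
  radius \<open>\<rho> = 2 C k\<^sup>r / n\<^sup>r\<close> around the true value \<open>T\<close> contains a majority, a majority
  ball exists, and the center of whichever one the median trick returns is within \<open>2 \<rho>\<close> of \<open>T\<close>
  (\<open>majority_balls_centers_close\<close>). The trick can fail only if at least half of the \<open>k\<close> estimates
  miss the ball around \<open>T\<close>. The parts are independent and identically distributed, since they are
  disjoint blocks of i.i.d. data, so these misses are independent events of one common probability,
  at most \<open>\<epsilon>\<^sub>0 < 1/2\<close>, and Hoeffding's inequality bounds the probability of failure by
  \<open>exp (- 2 k (1/2 - \<epsilon>\<^sub>0)\<^sup>2)\<close> (\<open>prob_half_of_independent_events\<close>,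
  \<open>median_trick_concentration\<close>). This is at most \<open>\<epsilon>\<close> as soon as \<open>k \<ge> \<kappa> ln (1/\<epsilon>)\<close> with
  \<open>\<kappa> = 1 / (2 (1/2 - \<epsilon>\<^sub>0)\<^sup>2)\<close>.

  The assumed guarantee for a single part speaks of the radius \<open>C / m\<^sup>r\<close> for the actual part size
  \<open>m = n div k\<close>, whereas \<open>\<rho>\<close> is formed with \<open>n / k\<close>. The factor \<open>2\<close> in \<open>\<rho>\<close> absorbs the rounding
  once \<open>m\<close> is large compared to \<open>\<bar>r\<bar>\<close> (\<open>part_size_rounding\<close>), and \<open>m\<close> is large because \<open>n\<close> exceeds
  a large multiple of \<open>ln (1/\<epsilon>)\<close>, hence of \<open>k\<close>. Finally, \<open>k\<^sup>r\<close> is turned into a multiple of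
  \<open>(ln (1/\<epsilon>))\<^sup>r\<close> by the upper bound on \<open>k\<close> if \<open>r \<ge> 0\<close> and by the lower bound if \<open>r < 0\<close>.
\<close>

text \<open>Two majorities overlap, and the triangle inequality through a shared estimate bounds the
  distance of the centers.\<close>

lemma majority_balls_centers_close:
  assumes "majority_ball k t \<rho> c" and "majority_ball k t \<rho>' c'"
  shows "dist c c' \<le> \<rho> + \<rho>'"
proof -
  let ?A = "{j. j < k \<and> t j \<in> cball c \<rho>}" and ?B = "{j. j < k \<and> t j \<in> cball c' \<rho>'}"
  have "card ?A + card ?B > k"
    using assms unfolding majority_ball_def by linarith
  moreover have "card (?A \<union> ?B) \<le> card {..<k}"
    by (rule card_mono) auto
  moreover have "card ?A + card ?B = card (?A \<union> ?B) + card (?A \<inter> ?B)"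
    by (rule card_Un_Int) auto
  ultimately have "card (?A \<inter> ?B) \<noteq> 0" unfolding card_lessThan by linarith
  then have "?A \<inter> ?B \<noteq> {}" by (metis card.empty)
  then obtain j where "t j \<in> cball c \<rho>" "t j \<in> cball c' \<rho>'" by blast
  then show ?thesis
    using dist_triangle[of c c' "t j"] by (simp add: dist_commute)
qed

text \<open>The number of events that occur is a sum of independent indicators with mean at most \<open>k p\<close>;
  reaching \<open>k / 2\<close> means exceeding that mean by \<open>k (1/2 - p)\<close>, to which Hoeffding's inequality
  applies. Measurability is recorded as well because the event serves as an upper bound for other
  events.\<close>

lemma (in prob_space) prob_half_of_independent_events:
  assumes Y: "indep_vars (\<lambda>_. N) Y {..<k}"
    and A: "A \<in> sets N"
    and p: "\<And>j. j < k \<Longrightarrow> prob {\<omega> \<in> space M. Y j \<omega> \<in> A} \<le> p"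
    and "p \<le> 1 / 2" and "k > 0"
  shows "prob {\<omega> \<in> space M. real (card {j. j < k \<and> Y j \<omega> \<in> A}) \<ge> real k / 2}
           \<le> exp (- 2 * real k * (1 / 2 - p)\<^sup>2)" (is ?bound)
    and "{\<omega> \<in> space M. real (card {j. j < k \<and> Y j \<omega> \<in> A}) \<ge> real k / 2} \<in> events"
      (is ?measurable)
proof -
  let ?Z = "\<lambda>j \<omega>. indicat_real A (Y j \<omega>)"
  interpret Hoeffding_ineq M "{..<k}" ?Z "\<lambda>_. 0" "\<lambda>_. 1" "\<Sum>j<k. expectation (?Z j)"
  proof unfold_locales
    show "indep_vars (\<lambda>_. borel) ?Z {..<k}"
      using A by (intro indep_vars_compose2[OF Y]) simp
  qed (auto simp: indicator_def)
  let ?\<mu> = "\<Sum>j<k. expectation (?Z j)"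
  have rv: "Y j \<in> measurable M N" if "j < k" for j
    using indep_vars_def[THEN iffD1, OF Y] that by blast
  have "expectation (?Z j) \<le> p" if "j < k" for j
  proof -
    have "expectation (?Z j) = expectation (indicator {\<omega> \<in> space M. Y j \<omega> \<in> A})"
      by (intro Bochner_Integration.integral_cong) (auto simp: indicator_def)
    also have "\<dots> = prob {\<omega> \<in> space M. Y j \<omega> \<in> A}"
      using rv[OF that] A by simp
    finally show ?thesis using p[OF that] by simp
  qed
  then have mean: "?\<mu> \<le> real k * p"
    using sum_bounded_above[of "{..<k}" "\<lambda>j. expectation (?Z j)" p] by simp
  \<comment> \<open>Hoeffding's inequality measures the deviation from the exact mean, so the threshold \<open>k / 2\<close>
    is written as mean plus \<open>\<delta>\<close>; only a lower bound for \<open>\<delta>\<close> is known.\<close>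
  define \<delta> where "\<delta> = real k / 2 - ?\<mu>"
  have threshold: "?\<mu> + \<delta> = real k / 2" by (simp add: \<delta>_def)
  have gap: "real k * (1 / 2 - p) \<le> \<delta>"
    unfolding \<delta>_def using mean by (simp add: algebra_simps)
  have gap0: "0 \<le> real k * (1 / 2 - p)" using \<open>p \<le> 1 / 2\<close> by simp
  have count: "(\<Sum>j<k. ?Z j \<omega>) = real (card {j. j < k \<and> Y j \<omega> \<in> A})" for \<omega>
  proof -
    have "(\<Sum>j<k. ?Z j \<omega>) = (\<Sum>j\<in>{j. j < k \<and> Y j \<omega> \<in> A}. 1)"
      by (rule sum.mono_neutral_cong_right) (auto simp: indicator_def)
    then show ?thesis by simp
  qed
  have "prob {\<omega> \<in> space M. (\<Sum>j<k. ?Z j \<omega>) \<ge> ?\<mu> + \<delta>} \<le> exp (- 2 * \<delta>\<^sup>2 / (\<Sum>j<k. (1 - 0)\<^sup>2))"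
    using gap gap0 \<open>k > 0\<close> by (intro Hoeffding_ineq_ge) auto
  also have "\<dots> = exp (- 2 * (\<delta>\<^sup>2 / real k))" by simp
  also have "\<dots> \<le> exp (- 2 * (real k * (1 / 2 - p)\<^sup>2))"
  proof -
    have "(real k * (1 / 2 - p))\<^sup>2 \<le> \<delta>\<^sup>2" using gap gap0 by (rule power_mono)
    then have "real k * (1 / 2 - p)\<^sup>2 \<le> \<delta>\<^sup>2 / real k"
      using \<open>k > 0\<close> by (simp add: field_simps power2_eq_square)
    then show ?thesis by simp
  qed
  finally show ?bound unfolding count threshold by (simp only: mult.assoc)
  have "{\<omega> \<in> space M. (\<Sum>j<k. ?Z j \<omega>) \<ge> real k / 2} \<in> events"
    by (intro borel_measurable_le borel_measurable_sum borel_measurable_const random_variable) auto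
  then show ?measurable unfolding count .
qed

text \<open>The parts are functions of disjoint blocks of the data. Each block, restricted to its own index
  set, is shifted back to \<open>{..<m}\<close> so that all parts live in the same product space.\<close>

lemma indep_vars_part:
  assumes "iid_data M S X"
  shows "prob_space.indep_vars M (\<lambda>_. PiM {..<m} (\<lambda>_. S)) (part X m) {..<k}"
proof -
  interpret prob_space M using assms by (simp add: iid_data_def)
  let ?K = "\<lambda>j. {j * m..<j * m + m}"
  have "indep_vars (\<lambda>j. PiM (?K j) (\<lambda>_. S)) (\<lambda>j \<omega>. restrict (\<lambda>i. X i \<omega>) (?K j)) {..<k}"
  proof (rule indep_vars_restrict)
    show "indep_vars (\<lambda>_. S) X UNIV" using assms by (simp add: iid_data_def)
    have "i div m = j" if "i \<in> ?K j" for i j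
      using that by (intro div_nat_eqI) (auto simp: mult.commute)
    then show "disjoint_family_on ?K {..<k}"
      unfolding disjoint_family_on_def by blast
  qed simp
  then have "indep_vars (\<lambda>_. PiM {..<m} (\<lambda>_. S))
      (\<lambda>j \<omega>. (\<lambda>x. \<lambda>i\<in>{..<m}. x (j * m + i)) (restrict (\<lambda>i. X i \<omega>) (?K j))) {..<k}"
    by (rule indep_vars_compose2)
      (intro measurable_restrict measurable_component_singleton, auto)
  then show ?thesis
    by (rule indep_vars_cong[THEN iffD1, rotated -1]) (auto simp: part_def fun_eq_iff)
qed

text \<open>The right-hand side does not mention \<open>j\<close>, so that a guarantee for the first part transfers to
  all of them. The whole data sequence is distributed as an infinite power of one distribution,
  and each part is an injective reindexing of that sequence.\<close>

lemma distr_part: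
  assumes "iid_data M S X"
  shows "distr M (PiM {..<m} (\<lambda>_. S)) (part X m j) = PiM {..<m} (\<lambda>_. distr M S (X 0))"
proof -
  interpret prob_space M using assms by (simp add: iid_data_def)
  let ?D = "distr M S (X 0)"
  have indep: "indep_vars (\<lambda>_. S) X UNIV" and same: "\<And>i. distr M S (X i) = ?D"
    using assms by (auto simp: iid_data_def)
  have rv: "\<And>i. X i \<in> measurable M S"
    using indep_vars_def[THEN iffD1, OF indep] by blast
  let ?shift = "\<lambda>x. \<lambda>i\<in>{..<m}. x (j * m + i)"
  have whole: "distr M (PiM UNIV (\<lambda>_. S)) (\<lambda>\<omega> i. X i \<omega>) = PiM UNIV (\<lambda>_. ?D)"
  proof -
    have "distr M (PiM UNIV (\<lambda>_. S)) (\<lambda>\<omega> i. X i \<omega>) = PiM UNIV (\<lambda>i. distr M S (X i))"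
      using indep_vars_iff_distr_eq_PiM[of UNIV X "\<lambda>_. S", OF UNIV_not_empty rv] indep
      by (simp add: restrict_UNIV)
    also have "\<dots> = PiM UNIV (\<lambda>_. ?D)" by (intro PiM_cong same refl)
    finally show ?thesis .
  qed
  have "distr M (PiM {..<m} (\<lambda>_. S)) (part X m j)
      = distr (distr M (PiM UNIV (\<lambda>_. S)) (\<lambda>\<omega> i. X i \<omega>)) (PiM {..<m} (\<lambda>_. S)) ?shift"
  proof (subst distr_distr)
    show "(\<lambda>\<omega> i. X i \<omega>) \<in> measurable M (PiM UNIV (\<lambda>_. S))"
      using measurable_space[OF rv] rv by (intro measurable_PiM_single') auto
  qed (auto intro!: measurable_restrict measurable_component_singleton simp: part_def[abs_def] comp_def)
  also have "\<dots> = distr (PiM UNIV (\<lambda>_. ?D)) (PiM {..<m} (\<lambda>_. ?D)) ?shift"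
    unfolding whole by (intro distr_cong sets_PiM_cong) auto
  also have "\<dots> = PiM {..<m} (\<lambda>_. ?D)"
    using rv by (intro distr_PiM_reindex) (auto intro: prob_space_distr)
  finally show ?thesis .
qed

text \<open>Up to the factor \<open>2\<close>, the part size \<open>n div k\<close> may be replaced by \<open>n / k\<close>: with \<open>m = n div k\<close>,
  the quotient \<open>q = n / (k m)\<close> lies between \<open>1\<close> and \<open>1 + 1/m\<close>, so \<open>ln (q\<^sup>r) \<le> \<bar>r\<bar> / m \<le> ln 2\<close>.
  The absolute value covers exponents of both signs.\<close>

lemma part_size_rounding:
  assumes "k > 0" and "n div k > 0" and "\<bar>r\<bar> \<le> ln 2 * real (n div k)"
  shows "1 / real (n div k) powr r \<le> 2 * real k powr r / real n powr r"
proof -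
  let ?m = "n div k"
  let ?q = "real n / (real k * real ?m)"
  have n: "n > 0" using assms by (metis div_0 less_nat_zero_code not_gr_zero)
  have lo: "k * ?m \<le> n" by simp
  have hi: "n \<le> k * (?m + 1)"
    using dividend_less_times_div[OF assms(1), of n] by simp
  have "real k * real ?m \<le> real n" using lo by (metis of_nat_le_iff of_nat_mult)
  then have q1: "1 \<le> ?q" using assms by simp
  have "real n \<le> real k * (real ?m + 1)"
    using hi by (metis of_nat_1 of_nat_add of_nat_le_iff of_nat_mult)
  then have q2: "?q \<le> 1 + 1 / real ?m" using assms by (simp add: field_simps)
  have "ln ?q \<le> 1 / real ?m"
    using q1 q2 ln_le_minus_one[of ?q] by linarith
  moreover have "0 \<le> ln ?q" using q1 by (rule ln_ge_zero)
  ultimately have "r * ln ?q \<le> \<bar>r\<bar> * (1 / real ?m)"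
    by (intro mult_mono) auto
  also have "\<dots> \<le> ln 2" using assms by (simp add: field_simps)
  finally have "exp (r * ln ?q) \<le> exp (ln 2)" by (simp only: exp_le_cancel_iff)
  then have "?q powr r \<le> 2"
    using q1 assms(1,2) n by (simp add: powr_def mult.commute)
  moreover have "?q powr r = real n powr r / (real k powr r * real ?m powr r)"
    by (simp add: powr_divide powr_mult)
  ultimately show ?thesis using assms n by (simp add: field_simps)
qed

text \<open>The core of the argument, for a given number of parts: a miss probability \<open>p\<close> below \<open>1/2\<close>
  becomes exponentially small in \<open>k\<close>, at the price of doubling the radius.\<close>

lemma median_trick_concentration:
  fixes E :: "nat \<Rightarrow> (nat \<Rightarrow> 'b) \<Rightarrow> real ^ 'd"
  defines "\<rho> C r k n \<equiv> 2 * C * real k powr r / real n powr r"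
  assumes iid: "iid_data M S X" and est: "is_estimator S E"
    and one: "measure M {\<omega> \<in> space M.
                norm (E (n div k) (part X (n div k) 0 \<omega>) - T) > \<rho> C r k n} \<le> p"
    and "p \<le> 1 / 2" and "k > 0"
    and trick: "median_trick M X E r C k n That"
  shows "measure M {\<omega> \<in> space M. norm (That \<omega> - T) > 2 * \<rho> C r k n}
           \<le> exp (- 2 * real k * (1 / 2 - p)\<^sup>2)"
proof -
  interpret prob_space M using iid by (simp add: iid_data_def)
  let ?m = "n div k" and ?\<rho> = "\<rho> C r k n"
  let ?P = "PiM {..<?m} (\<lambda>_. S)"
  \<comment> \<open>the data sets of one part on which the estimate misses the ball around \<open>T\<close>\<close>
  define A where "A = {x \<in> space ?P. norm (E ?m x - T) > ?\<rho>}"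
  have [measurable]: "E ?m \<in> borel_measurable ?P" using est by (simp add: is_estimator_def)
  have A: "A \<in> sets ?P" unfolding A_def by measurable
  have indep: "indep_vars (\<lambda>_. ?P) (part X ?m) {..<k}" by (rule indep_vars_part[OF iid])
  have rv: "part X ?m j \<in> measurable M ?P" if "j < k" for j
    using indep_vars_def[THEN iffD1, OF indep] that by blast
  have in_A: "part X ?m j \<omega> \<in> A \<longleftrightarrow> norm (E ?m (part X ?m j \<omega>) - T) > ?\<rho>"
    if "j < k" "\<omega> \<in> space M" for j \<omega>
    using measurable_space[OF rv] that by (auto simp: A_def)
  have A_prob: "prob {\<omega> \<in> space M. part X ?m j \<omega> \<in> A} = measure (PiM {..<?m} (\<lambda>_. distr M S (X 0))) A"
    if "j < k" for j
    using measure_distr[OF rv[OF that] A] unfolding distr_part[OF iid]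
    by (simp add: vimage_def Int_def conj_commute)
  have "prob {\<omega> \<in> space M. part X ?m j \<omega> \<in> A} \<le> p" if "j < k" for j
  proof -
    have "prob {\<omega> \<in> space M. part X ?m j \<omega> \<in> A} = prob {\<omega> \<in> space M. part X ?m 0 \<omega> \<in> A}"
      using A_prob that \<open>k > 0\<close> by simp
    also have "{\<omega> \<in> space M. part X ?m 0 \<omega> \<in> A}
        = {\<omega> \<in> space M. norm (E ?m (part X ?m 0 \<omega>) - T) > ?\<rho>}"
      using in_A[OF \<open>k > 0\<close>] by blast
    finally show ?thesis using one by simp
  qed
  note half = prob_half_of_independent_events[OF indep A this \<open>p \<le> 1 / 2\<close> \<open>k > 0\<close>]
  have "{\<omega> \<in> space M. norm (That \<omega> - T) > 2 * ?\<rho>}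
      \<subseteq> {\<omega> \<in> space M. real (card {j. j < k \<and> part X ?m j \<omega> \<in> A}) \<ge> real k / 2}"
  proof safe
    fix \<omega> assume \<omega>: "\<omega> \<in> space M" and far: "norm (That \<omega> - T) > 2 * ?\<rho>"
    let ?t = "\<lambda>j. E ?m (part X ?m j \<omega>)"
    have "\<not> majority_ball k ?t ?\<rho> T"
    proof
      assume T: "majority_ball k ?t ?\<rho> T"
      then have "majority_ball k ?t ?\<rho> (That \<omega>)"
        using trick \<omega> unfolding median_trick_def \<rho>_def Let_def by blast
      from majority_balls_centers_close[OF this T] far show False
        by (simp add: dist_norm)
    qed
    moreover have "card {j. j < k \<and> ?t j \<in> cball T ?\<rho>} + card {j. j < k \<and> part X ?m j \<omega> \<in> A} = k"
    proof -
      have "{j. j < k \<and> part X ?m j \<omega> \<in> A} = {..<k} - {j. j < k \<and> ?t j \<in> cball T ?\<rho>}"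
        using in_A[OF _ \<omega>] by (auto simp: dist_norm norm_minus_commute not_le)
      then show ?thesis
        using card_mono[of "{..<k}" "{j. j < k \<and> ?t j \<in> cball T ?\<rho>}"]
        by (simp add: card_Diff_subset subset_iff)
    qed
    ultimately show "real (card {j. j < k \<and> part X ?m j \<omega> \<in> A}) \<ge> real k / 2"
      unfolding majority_ball_def by linarith
  qed
  then have "prob {\<omega> \<in> space M. norm (That \<omega> - T) > 2 * ?\<rho>}
      \<le> prob {\<omega> \<in> space M. real (card {j. j < k \<and> part X ?m j \<omega> \<in> A}) \<ge> real k / 2}"
    using half(2) by (rule finite_measure_mono)
  also note half(1)
  finally show ?thesis .
qed

text \<open>With a negative constant the event in the guarantee would be certain, because norms are
  nonnegative.\<close>

lemma guarantee_constant_nonneg: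
  assumes "prob_space M" and "estimator_guarantee M X E T r Nbar Cbar" and "0 < \<epsilon>" and "\<epsilon> < 1"
  shows "Cbar \<epsilon> \<ge> 0"
proof (rule ccontr)
  assume neg: "\<not> Cbar \<epsilon> \<ge> 0"
  obtain n :: nat where n: "real n > max 0 (Nbar \<epsilon>)" using reals_Archimedean2[of "max 0 (Nbar \<epsilon>)"] by auto
  from n neg have "Cbar \<epsilon> / real n powr r < 0" by (simp add: divide_neg_pos)
  then have "Cbar \<epsilon> / real n powr r < norm (E n (part X n 0 \<omega>) - T)" for \<omega>
    by (rule less_le_trans) simp
  moreover have "measure M {\<omega> \<in> space M. norm (E n (part X n 0 \<omega>) - T) > Cbar \<epsilon> / real n powr r} \<le> \<epsilon>"
    using assms n by (simp add: estimator_guarantee_def)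
  ultimately have "measure M (space M) \<le> \<epsilon>" by simp
  then show False using assms by (simp add: prob_space.prob_space)
qed

theorem lemma3p3:
  fixes \<epsilon>\<^sub>0 :: real
  assumes "0 < \<epsilon>\<^sub>0" and "\<epsilon>\<^sub>0 < 1 / 2"
  shows "\<exists>\<kappa>>0. \<forall>(M :: 'w measure) (S :: 'b measure) (X :: nat \<Rightarrow> 'w \<Rightarrow> 'b)
           (T :: real ^ 'd) (E :: nat \<Rightarrow> (nat \<Rightarrow> 'b) \<Rightarrow> real ^ 'd)
           (r :: real) (Nbar :: real \<Rightarrow> real) (Cbar :: real \<Rightarrow> real)
           (\<epsilon>max :: real) (K :: real) (\<nu> :: real \<Rightarrow> nat).
         iid_data M S X \<and> is_estimator S E \<and> estimator_guarantee M X E T r Nbar Cbar \<and>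
         \<epsilon>max < 1 \<and> log_many_parts \<kappa> K \<epsilon>max \<nu> \<longrightarrow>
         (\<exists>C\<^sub>0>0. \<exists>c\<^sub>0>0. \<exists>N\<^sub>0>0.
            \<forall>(\<epsilon> :: real) (n :: nat) (That :: 'w \<Rightarrow> real ^ 'd).
              0 < \<epsilon> \<and> \<epsilon> \<le> \<epsilon>max \<and> real n > N\<^sub>0 * ln (1 / \<epsilon>) \<and>
              median_trick M X E r (Cbar \<epsilon>\<^sub>0) (\<nu> \<epsilon>) n That \<longrightarrow>
              measure M {\<omega> \<in> space M.
                norm (That \<omega> - T) > C\<^sub>0 * (c\<^sub>0 * ln (1 / \<epsilon>)) powr r / real n powr r} \<le> \<epsilon>)"
proof -
  define \<kappa> where "\<kappa> = 1 / (2 * (1 / 2 - \<epsilon>\<^sub>0)\<^sup>2)"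
  have \<kappa>: "\<kappa> > 0" using assms by (simp add: \<kappa>_def)
  show ?thesis
  proof (rule exI[of _ \<kappa>], rule conjI[OF \<kappa>], intro allI impI, goal_cases)
    case (1 M S X T E r Nbar Cbar \<epsilon>max K \<nu>)
    then have iid: "iid_data M S X" and est: "is_estimator S E"
      and guarantee: "estimator_guarantee M X E T r Nbar Cbar"
      and "\<epsilon>max < 1" and parts: "log_many_parts \<kappa> K \<epsilon>max \<nu>"
      by auto
    interpret prob_space M using iid by (simp add: iid_data_def)
    have C: "Cbar \<epsilon>\<^sub>0 \<ge> 0"
      using guarantee_constant_nonneg[OF prob_space_axioms guarantee] assms by simp
    \<comment> \<open>\<open>K\<close> can fail to be positive if \<open>\<epsilon>max \<le> 0\<close>, whereas the constants have to be positive
      in every case. Likewise \<open>1\<close> is added to \<open>4 * Cbar \<epsilon>\<^sub>0\<close>, which may be \<open>0\<close>.\<close>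
    define K' where "K' = max K 1"
    define c\<^sub>0 where "c\<^sub>0 = (if r \<ge> 0 then K' else \<kappa>)"
    define C\<^sub>0 where "C\<^sub>0 = 4 * Cbar \<epsilon>\<^sub>0 + 1"
    \<comment> \<open>\<open>N\<^sub>1\<close> is the part size from which on both the guarantee for \<open>\<epsilon>\<^sub>0\<close> and the rounding
      estimate apply. The extra \<open>1\<close> in \<open>N\<^sub>0\<close> pays for rounding \<open>n / k\<close> down.\<close>
    define N\<^sub>1 where "N\<^sub>1 = max 0 (Nbar \<epsilon>\<^sub>0) + \<bar>r\<bar> / ln 2"
    define N\<^sub>0 where "N\<^sub>0 = K' * (1 + N\<^sub>1)"
    have K': "K' > 0" "K' \<ge> K" by (auto simp: K'_def)
    have N1: "N\<^sub>1 \<ge> 0" "N\<^sub>1 \<ge> Nbar \<epsilon>\<^sub>0" "N\<^sub>1 \<ge> \<bar>r\<bar> / ln 2"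
      using ln_gt_zero[of "2::real"] by (auto simp: N\<^sub>1_def add_increasing2)
    have pos: "C\<^sub>0 > 0" "c\<^sub>0 > 0" "N\<^sub>0 > 0"
      using C K' \<kappa> N1 by (auto simp: C\<^sub>0_def c\<^sub>0_def N\<^sub>0_def)
    have "prob {\<omega> \<in> space M. norm (That \<omega> - T) > C\<^sub>0 * (c\<^sub>0 * ln (1 / \<epsilon>)) powr r / real n powr r} \<le> \<epsilon>"
      if \<epsilon>: "0 < \<epsilon>" "\<epsilon> \<le> \<epsilon>max" and n: "real n > N\<^sub>0 * ln (1 / \<epsilon>)"
        and trick: "median_trick M X E r (Cbar \<epsilon>\<^sub>0) (\<nu> \<epsilon>) n That" for \<epsilon> n That
    proof -
      define L where "L = ln (1 / \<epsilon>)"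
      define k where "k = \<nu> \<epsilon>"
      define m where "m = n div k"
      have L: "L > 0" using \<epsilon> \<open>\<epsilon>max < 1\<close> by (simp add: L_def)
      have k_lo: "\<kappa> * L \<le> real k" and "real k \<le> K * L"
        using parts \<epsilon> by (auto simp: log_many_parts_def k_def L_def)
      then have k_hi: "real k \<le> K' * L" using K' L by (meson mult_right_mono less_imp_le order_trans)
      have k: "k > 0" using k_lo mult_pos_pos[OF \<kappa> L] by linarith
      have "real k * (1 + N\<^sub>1) \<le> K' * L * (1 + N\<^sub>1)"
        using k_hi N1 by (intro mult_right_mono) auto
      also have "\<dots> < real n" using n by (simp add: N\<^sub>0_def L_def mult_ac)
      also have "\<dots> < real k * (real m + 1)"
      proof -
        have "real n < real (k * (m + 1))"
          using dividend_less_times_div[OF k, of n] unfolding m_def of_nat_less_iff by simp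
        then show ?thesis by (simp add: distrib_left)
      qed
      finally have m: "real m > N\<^sub>1" using k by simp
      then have m0: "m > 0" using N1 by linarith
      define \<rho> where "\<rho> = 2 * Cbar \<epsilon>\<^sub>0 * real k powr r / real n powr r"
      have "\<bar>r\<bar> / ln 2 \<le> real m" using m N1(3) by linarith
      then have "\<bar>r\<bar> \<le> ln 2 * real m" by (simp add: pos_divide_le_eq mult.commute)
      then have "1 / real m powr r \<le> 2 * real k powr r / real n powr r"
        using part_size_rounding k m0 unfolding m_def by blast
      from mult_left_mono[OF this C] have radius: "Cbar \<epsilon>\<^sub>0 / real m powr r \<le> \<rho>"
        by (simp add: \<rho>_def mult_ac)
      have "prob {\<omega> \<in> space M. norm (E m (part X m 0 \<omega>) - T) > \<rho>}
          \<le> prob {\<omega> \<in> space M. norm (E m (part X m 0 \<omega>) - T) > Cbar \<epsilon>\<^sub>0 / real m powr r}"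
      proof (rule finite_measure_mono)
        have "E m \<in> borel_measurable (PiM {..<m} (\<lambda>_. S))" using est by (simp add: is_estimator_def)
        moreover have "part X m 0 \<in> measurable M (PiM {..<m} (\<lambda>_. S))"
          using indep_vars_part[OF iid, of m 1] by (auto simp: indep_vars_def)
        ultimately have [measurable]: "(\<lambda>\<omega>. E m (part X m 0 \<omega>)) \<in> borel_measurable M"
          by (rule measurable_compose[rotated])
        show "{\<omega> \<in> space M. norm (E m (part X m 0 \<omega>) - T) > Cbar \<epsilon>\<^sub>0 / real m powr r} \<in> events"
          by measurable
      qed (use radius in auto)
      also have "\<dots> \<le> \<epsilon>\<^sub>0"
        using guarantee assms m N1(2) m0 by (simp add: estimator_guarantee_def)
      finally have one: "prob {\<omega> \<in> space M. norm (E m (part X m 0 \<omega>) - T) > \<rho>} \<le> \<epsilon>\<^sub>0" .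
      \<comment> \<open>\<open>x powr r\<close> increases in \<open>x\<close> for \<open>r \<ge> 0\<close> and decreases for \<open>r < 0\<close>, which is why
        \<open>c\<^sub>0\<close> comes from the upper or the lower bound on the number of parts.\<close>
      have "real k powr r \<le> (c\<^sub>0 * L) powr r"
        using k_lo k_hi k \<kappa> L by (auto simp: c\<^sub>0_def intro: powr_mono2 powr_mono2')
      then have "4 * Cbar \<epsilon>\<^sub>0 * real k powr r \<le> C\<^sub>0 * (c\<^sub>0 * L) powr r"
        using C by (intro mult_mono) (auto simp: C\<^sub>0_def)
      then have "2 * \<rho> \<le> C\<^sub>0 * (c\<^sub>0 * L) powr r / real n powr r"
        unfolding \<rho>_def by (simp add: divide_right_mono)
      then have "prob {\<omega> \<in> space M. norm (That \<omega> - T) > C\<^sub>0 * (c\<^sub>0 * L) powr r / real n powr r}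
          \<le> prob {\<omega> \<in> space M. norm (That \<omega> - T) > 2 * \<rho>}"
      proof (intro finite_measure_mono)
        have [measurable]: "That \<in> borel_measurable M" using trick by (simp add: median_trick_def)
        show "{\<omega> \<in> space M. norm (That \<omega> - T) > 2 * \<rho>} \<in> events" by measurable
      qed auto
      also have "\<dots> \<le> exp (- 2 * real k * (1 / 2 - \<epsilon>\<^sub>0)\<^sup>2)"
        unfolding \<rho>_def
        by (rule median_trick_concentration[OF iid est])
          (use one assms k trick in \<open>auto simp: m_def \<rho>_def k_def\<close>)
      also have "\<dots> \<le> exp (- L)"
      proof -
        have "2 * (1 / 2 - \<epsilon>\<^sub>0)\<^sup>2 * (\<kappa> * L) \<le> 2 * (1 / 2 - \<epsilon>\<^sub>0)\<^sup>2 * real k"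
          using k_lo by (intro mult_left_mono) auto
        moreover have "2 * (1 / 2 - \<epsilon>\<^sub>0)\<^sup>2 * \<kappa> = 1" using assms by (simp add: \<kappa>_def)
        ultimately have "L \<le> 2 * (1 / 2 - \<epsilon>\<^sub>0)\<^sup>2 * real k"
          by (metis mult.assoc mult_1)
        then show ?thesis by (simp add: mult_ac)
      qed
      also have "\<dots> = \<epsilon>" using \<epsilon> by (simp add: L_def ln_div)
      finally show ?thesis by (simp add: L_def)
    qed
    with pos show ?case by blast
  qed
qed

end
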